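(* Let $\Omega(\mathbb{R})$ be the frame of open subsets of the real line (usual topology) and let $K(\Omega(\mathbb{R}))=\{(U,V)\mid U\subseteq\mathbb{R} \text{ open},\ V\subseteq \mathbb{R}\text{ regular open},\ U\subseteq V\}$, ordered componentwise by inclusion (this is a frame). Then the frame $\mathsf{S}_c(K(\Omega(\mathbb{R})))$ of joins of closed sublocales of $K(\Omega(\mathbb{R}))$, ordered by inclusion, is not a coframe.
   Context: A frame is a complete lattice satisfying $a\wedge\bigvee_i b_i=\bigvee_i(a\wedge b_i)$; a coframe is a complete lattice whose order dual is a frame. Frames are also called locales. In a frame, $\to$ denotes the Heyting implication and $a^*=a\to 0$ the pseudocomplement. For a frame $L$, $B_L=\{a\in L\mid a^{**}=a\}$ is its Booleanization (with the order of $L$; the join in $B_L$ of a family $a_i\in B_L$ is $(\bigvee_i a_i)^{**}$, and meets are as in $L$). Define $K(L)=\{(a,b)\in L\times B_L\mid a\le b\}$, which is a subframe of $L\times B_L$ (componentwise frame structure), closed also under arbitrary meets. For $L=\Omega(\mathbb{R})$, $B_L$ consists of the regular open sets, i.e. the open $V$ with $V=\mathrm{int}(\overline{V})$. A sublocale of a locale $L$ is a subset $S\subseteq L$ closed under arbitrary meets (so $1\in S$) such that $a\to s\in S$ for all $a\in L$, $s\in S$. The set $\mathsf{S}(L)$ of all sublocales, ordered by inclusion, is a coframe with meets given by intersection and joins given by $\bigvee_i S_i=\{\bigwedge M\mid M\subseteq\bigcup_i S_i\}$; its least element is $\{1\}$ and its greatest element is $L$. For $a\in L$, the closed sublocale is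 $\mathfrak{c}_L(a)=\{x\in L\mid x\ge a\}$. Let $\mathsf{S}_c(L)=\{\bigvee_{a\in A}\mathfrak{c}_L(a)\mid A\subseteq L\}$ (joins computed in $\mathsf{S}(L)$), ordered by inclusion. It is known that $\mathsf{S}_c(L)$ is always a frame (its joins are those of $\mathsf{S}(L)$). *)

theory Defs
  imports "HOL-Algebra.Complete_Lattice" "HOL-Analysis.Analysis"
begin

section \<open>Frames and coframes\<close>

locale frame = complete_lattice +
  assumes meet_sup_distrib:
    "\<lbrakk>a \<in> carrier L; B \<subseteq> carrier L\<rbrakk> \<Longrightarrow> a \<sqinter> \<Squnion>B = \<Squnion>((\<lambda>b. a \<sqinter> b) ` B)"

definition coframe :: "('a, 'b) gorder_scheme \<Rightarrow> bool"
  where "coframe L \<longleftrightarrow> frame (inv_gorder L)"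

definition heyting_imp :: "('a, 'b) gorder_scheme \<Rightarrow> 'a \<Rightarrow> 'a \<Rightarrow> 'a"
  where "heyting_imp L a b = \<Squnion>\<^bsub>L\<^esub>{c \<in> carrier L. a \<sqinter>\<^bsub>L\<^esub> c \<sqsubseteq>\<^bsub>L\<^esub> b}"

definition pseudocomplement :: "('a, 'b) gorder_scheme \<Rightarrow> 'a \<Rightarrow> 'a"
  where "pseudocomplement L a = heyting_imp L a \<bottom>\<^bsub>L\<^esub>"

definition booleanization :: "('a, 'b) gorder_scheme \<Rightarrow> 'a gorder"
  where "booleanization L =
    \<lparr>carrier = {a \<in> carrier L. pseudocomplement L (pseudocomplement L a) = a},
     eq = (=), le = le L\<rparr>"

definition K_frame :: "('a, 'b) gorder_scheme \<Rightarrow> ('a \<times> 'a) gorder"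
  where "K_frame L =
    \<lparr>carrier = {(a, b). a \<in> carrier L \<and> b \<in> carrier (booleanization L) \<and> a \<sqsubseteq>\<^bsub>L\<^esub> b},
     eq = (=), le = (\<lambda>(a, b) (c, d). a \<sqsubseteq>\<^bsub>L\<^esub> c \<and> b \<sqsubseteq>\<^bsub>L\<^esub> d)\<rparr>"

text \<open>The frame of open subsets of the topological space given by the type.\<close>

definition open_sets :: "'a::topological_space set gorder"
  where "open_sets = \<lparr>carrier = {U. open U}, eq = (=), le = (\<subseteq>)\<rparr>"

section \<open>Sublocales\<close>

text \<open>Closure under the empty meet puts the top element into every sublocale.\<close>

definition is_sublocale :: "('a, 'b) gorder_scheme \<Rightarrow> 'a set \<Rightarrow> bool"
  where "is_sublocale L S \<longleftrightarrow>
    S \<subseteq> carrier L \<and>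
    (\<forall>M. M \<subseteq> S \<longrightarrow> \<Sqinter>\<^bsub>L\<^esub>M \<in> S) \<and>
    (\<forall>a \<in> carrier L. \<forall>s \<in> S. heyting_imp L a s \<in> S)"

definition sublocales :: "('a, 'b) gorder_scheme \<Rightarrow> 'a set gorder"
  where "sublocales L = \<lparr>carrier = {S. is_sublocale L S}, eq = (=), le = (\<subseteq>)\<rparr>"

definition closed_sublocale :: "('a, 'b) gorder_scheme \<Rightarrow> 'a \<Rightarrow> 'a set"
  where "closed_sublocale L a = {x \<in> carrier L. a \<sqsubseteq>\<^bsub>L\<^esub> x}"

definition closed_joins :: "('a, 'b) gorder_scheme \<Rightarrow> 'a set gorder"
  where "closed_joins L =
    \<lparr>carrier = {\<Squnion>\<^bsub>sublocales L\<^esub>(closed_sublocale L ` A) | A. A \<subseteq> carrier L},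
     eq = (=), le = (\<subseteq>)\<rparr>"

section \<open>Basic facts\<close>

lemma is_sublocaleD:
  assumes "is_sublocale L S"
  shows "x \<in> S \<Longrightarrow> x \<in> carrier L" "M \<subseteq> S \<Longrightarrow> \<Sqinter>\<^bsub>L\<^esub>M \<in> S"
    "\<lbrakk>a \<in> carrier L; s \<in> S\<rbrakk> \<Longrightarrow> heyting_imp L a s \<in> S"
  using assms by (auto simp: is_sublocale_def)

lemma partial_order_subsets: "partial_order \<lparr>carrier = C, eq = (=), le = (\<subseteq>)\<rparr>"
  by unfold_locales auto

context frame
begin

lemma imp_closed: "heyting_imp L a b \<in> carrier L"
  unfolding heyting_imp_def by (rule sup_closed) auto

lemma imp_galois:
  assumes "a \<in> carrier L" "b \<in> carrier L" "c \<in> carrier L"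
  shows "c \<sqsubseteq> heyting_imp L a b \<longleftrightarrow> a \<sqinter> c \<sqsubseteq> b"
proof
  assume "a \<sqinter> c \<sqsubseteq> b"
  then show "c \<sqsubseteq> heyting_imp L a b"
    unfolding heyting_imp_def using assms by (intro sup_upper) auto
next
  let ?C = "{c \<in> carrier L. a \<sqinter> c \<sqsubseteq> b}"
  assume c: "c \<sqsubseteq> heyting_imp L a b"
  have "a \<sqinter> \<Squnion>?C = \<Squnion>((\<lambda>c. a \<sqinter> c) ` ?C)"
    by (rule meet_sup_distrib) (use assms in auto)
  also have "\<dots> \<sqsubseteq> b"
    by (rule sup_least) (use assms in auto)
  finally have *: "a \<sqinter> heyting_imp L a b \<sqsubseteq> b"
    by (simp add: heyting_imp_def)
  have "a \<sqinter> c \<sqsubseteq> a \<sqinter> heyting_imp L a b"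
    using assms c imp_closed
    by (meson meet_le meet_left meet_right meet_closed le_trans)
  with * show "a \<sqinter> c \<sqsubseteq> b"
    using assms imp_closed by (meson le_trans meet_closed)
qed

lemma le_inf_iff:
  assumes "M \<subseteq> carrier L" "z \<in> carrier L"
  shows "z \<sqsubseteq> \<Sqinter>M \<longleftrightarrow> (\<forall>m\<in>M. z \<sqsubseteq> m)"
  using assms by (meson inf_closed inf_greatest inf_lower le_trans subsetD)

lemma eq_from_below:
  assumes "x \<in> carrier L" "y \<in> carrier L"
    and "\<And>z. z \<in> carrier L \<Longrightarrow> z \<sqsubseteq> x \<longleftrightarrow> z \<sqsubseteq> y"
  shows "x = y"
  using assms by (meson le_antisym le_refl)

lemma imp_inf:
  assumes "a \<in> carrier L" "M \<subseteq> carrier L"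
  shows "heyting_imp L a (\<Sqinter>M) = \<Sqinter>(heyting_imp L a ` M)"
proof (rule eq_from_below)
  have sub: "heyting_imp L a ` M \<subseteq> carrier L"
    using imp_closed by auto
  then show "\<Sqinter>(heyting_imp L a ` M) \<in> carrier L" by simp
  fix z assume z: "z \<in> carrier L"
  show "z \<sqsubseteq> heyting_imp L a (\<Sqinter>M) \<longleftrightarrow> z \<sqsubseteq> \<Sqinter>(heyting_imp L a ` M)"
    using assms z sub by (auto simp: le_inf_iff imp_galois subset_iff)
qed (rule imp_closed)

lemma closed_sublocale: 
  assumes "a \<in> carrier L"
  shows "is_sublocale L (closed_sublocale L a)"
  unfolding is_sublocale_def
proof (intro conjI allI impI ballI)
  fix M assume "M \<subseteq> closed_sublocale L a"
  then show "\<Sqinter>M \<in> closed_sublocale L a"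
    using assms by (auto simp: closed_sublocale_def subset_iff intro!: inf_greatest)
next
  fix b s assume b: "b \<in> carrier L" and s: "s \<in> closed_sublocale L a"
  then have s': "s \<in> carrier L" "a \<sqsubseteq> s" by (auto simp: closed_sublocale_def)
  then have "b \<sqinter> a \<sqsubseteq> s"
    using assms b by (meson le_trans meet_closed meet_right)
  then show "heyting_imp L b s \<in> closed_sublocale L a"
    using assms b s' by (simp add: closed_sublocale_def imp_closed imp_galois)
qed (auto simp: closed_sublocale_def)

lemma inf_inf:
  assumes "U \<subseteq> carrier L" "X \<subseteq> {\<Sqinter>M | M. M \<subseteq> U}"
  shows "\<exists>M \<subseteq> U. \<Sqinter>X = \<Sqinter>M"
proof -
  let ?M = "{m \<in> U. \<exists>x\<in>X. x \<sqsubseteq> m}"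
  have X: "X \<subseteq> carrier L"
    using assms by auto
  have M: "?M \<subseteq> carrier L" using assms by auto
  have "\<Sqinter>X = \<Sqinter>?M"
  proof (rule eq_from_below)
    fix z assume z: "z \<in> carrier L"
    show "z \<sqsubseteq> \<Sqinter>X \<longleftrightarrow> z \<sqsubseteq> \<Sqinter>?M"
    proof
      assume "z \<sqsubseteq> \<Sqinter>X"
      then show "z \<sqsubseteq> \<Sqinter>?M"
        using z X M assms(1) by (auto simp: le_inf_iff) (meson le_trans subsetD)
    next
      assume *: "z \<sqsubseteq> \<Sqinter>?M"
      have "z \<sqsubseteq> x" if x: "x \<in> X" for x
      proof -
        obtain N where N: "N \<subseteq> U" "x = \<Sqinter>N" using x assms(2) by auto
        have "x \<sqsubseteq> n" if "n \<in> N" for n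
          using N that assms(1) by (auto intro!: inf_lower)
        then have "N \<subseteq> ?M" using N x by blast
        then have "\<forall>m\<in>N. z \<sqsubseteq> m" using * z M by (auto simp: le_inf_iff)
        then show ?thesis using N z assms(1) by (auto simp: le_inf_iff)
      qed
      then show "z \<sqsubseteq> \<Sqinter>X" using z X by (simp add: le_inf_iff)
    qed
  qed (use X M in simp_all)
  then show ?thesis by (intro exI[of _ ?M]) auto
qed

lemma sublocale_join:
  assumes "\<And>S. S \<in> \<S> \<Longrightarrow> is_sublocale L S"
  shows "least (sublocales L) {\<Sqinter>M | M. M \<subseteq> \<Union>\<S>} (Upper (sublocales L) \<S>)"
proof (rule least_UpperI)
  have U: "\<Union>\<S> \<subseteq> carrier L"
    using assms is_sublocaleD(1) by (meson Sup_least subsetI)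
  show "\<S> \<subseteq> carrier (sublocales L)"
    using assms by (auto simp: sublocales_def)
  have "\<Sqinter>X \<in> {\<Sqinter>M | M. M \<subseteq> \<Union>\<S>}" if "X \<subseteq> {\<Sqinter>M | M. M \<subseteq> \<Union>\<S>}" for X
    using inf_inf[OF U that] by (simp add: conj_commute)
  moreover have "heyting_imp L a (\<Sqinter>M) \<in> {\<Sqinter>M | M. M \<subseteq> \<Union>\<S>}"
    if a: "a \<in> carrier L" and M: "M \<subseteq> \<Union>\<S>" for a M
  proof -
    have "heyting_imp L a (\<Sqinter>M) = \<Sqinter>(heyting_imp L a ` M)"
      using a M U by (intro imp_inf) auto
    moreover have "heyting_imp L a ` M \<subseteq> \<Union>\<S>"
    proof
      fix y assume "y \<in> heyting_imp L a ` M"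
      then obtain m S where m: "y = heyting_imp L a m" "m \<in> S" "S \<in> \<S>"
        using M by auto
      then have "y \<in> S"
        using is_sublocaleD(3)[OF assms a] by simp
      with m show "y \<in> \<Union>\<S>" by blast
    qed
    ultimately show ?thesis by (intro CollectI exI conjI)
  qed
  moreover have "{\<Sqinter>M | M. M \<subseteq> \<Union>\<S>} \<subseteq> carrier L"
    using U by (auto intro!: inf_closed)
  ultimately have "is_sublocale L {\<Sqinter>M | M. M \<subseteq> \<Union>\<S>}"
    unfolding is_sublocale_def by (intro conjI allI impI ballI) auto
  then show "{\<Sqinter>M | M. M \<subseteq> \<Union>\<S>} \<in> carrier (sublocales L)"
    by (simp add: sublocales_def)
  fix S assume S: "S \<in> \<S>"
  have "\<exists>M. x = \<Sqinter>M \<and> M \<subseteq> \<Union>\<S>" if "x \<in> S" for x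
    using that S U by (intro exI[of _ "{x}"]) auto
  then show "S \<sqsubseteq>\<^bsub>sublocales L\<^esub> {\<Sqinter>M | M. M \<subseteq> \<Union>\<S>}"
    unfolding sublocales_def by auto
next
  fix T assume "T \<in> Upper (sublocales L) \<S>"
  then have "is_sublocale L T" "\<Union>\<S> \<subseteq> T"
    using assms by (auto simp: Upper_def sublocales_def)
  then have "\<Sqinter>M \<in> T" if "M \<subseteq> \<Union>\<S>" for M
    using that by (intro is_sublocaleD(2)) auto
  then show "{\<Sqinter>M | M. M \<subseteq> \<Union>\<S>} \<sqsubseteq>\<^bsub>sublocales L\<^esub> T"
    unfolding sublocales_def by auto
qed

lemma sublocale_sup:
  assumes "\<And>S. S \<in> \<S> \<Longrightarrow> is_sublocale L S"
  shows "\<Squnion>\<^bsub>sublocales L\<^esub>\<S> = {\<Sqinter>M | M. M \<subseteq> \<Union>\<S>}"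
proof -
  interpret P: partial_order "sublocales L"
    unfolding sublocales_def by (rule partial_order_subsets)
  show ?thesis
    unfolding Lattice.sup_def
    using sublocale_join[OF assms] P.least_unique by (intro some_equality) blast+
qed

lemma complete_lattice_sublocales: "complete_lattice (sublocales L)"
proof -
  interpret P: partial_order "sublocales L"
    unfolding sublocales_def by (rule partial_order_subsets)
  show ?thesis
  proof (rule P.complete_latticeI)
    fix \<S> assume "\<S> \<subseteq> carrier (sublocales L)"
    then have S: "\<And>S. S \<in> \<S> \<Longrightarrow> is_sublocale L S" by (auto simp: sublocales_def)
    show "\<exists>s. least (sublocales L) s (Upper (sublocales L) \<S>)"
      using sublocale_join[OF S] by blast
    have "greatest (sublocales L) (carrier L \<inter> \<Inter>\<S>) (Lower (sublocales L) \<S>)"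
    proof (rule greatest_LowerI)
      have "\<Sqinter>M \<in> carrier L \<inter> \<Inter>\<S>" if "M \<subseteq> carrier L \<inter> \<Inter>\<S>" for M
      proof -
        have "\<Sqinter>M \<in> S" if "S \<in> \<S>" for S
          using that S \<open>M \<subseteq> carrier L \<inter> \<Inter>\<S>\<close> by (intro is_sublocaleD(2)) auto
        then show ?thesis using that by auto
      qed
      moreover have "heyting_imp L a s \<in> carrier L \<inter> \<Inter>\<S>"
        if "a \<in> carrier L" "s \<in> carrier L \<inter> \<Inter>\<S>" for a s
        using that imp_closed is_sublocaleD(3)[OF S] by (simp add: Ball_def)
      ultimately have "is_sublocale L (carrier L \<inter> \<Inter>\<S>)"
        unfolding is_sublocale_def by (intro conjI allI impI ballI) simp_all
      then show "carrier L \<inter> \<Inter>\<S> \<in> carrier (sublocales L)"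
        by (simp add: sublocales_def)
    next
      fix T assume "T \<in> Lower (sublocales L) \<S>"
      then have "T \<subseteq> carrier L" "\<And>S. S \<in> \<S> \<Longrightarrow> T \<subseteq> S"
        using S by (auto simp: Lower_def sublocales_def dest: is_sublocaleD(1))
      then show "T \<sqsubseteq>\<^bsub>sublocales L\<^esub> carrier L \<inter> \<Inter>\<S>"
        by (auto simp: sublocales_def)
    qed (use S in \<open>auto simp: sublocales_def\<close>)
    then show "\<exists>i. greatest (sublocales L) i (Lower (sublocales L) \<S>)" by blast
  qed
qed

abbreviation (input) "cjoin A \<equiv> \<Squnion>\<^bsub>sublocales L\<^esub>(closed_sublocale L ` A)"

lemma cjoin_sublocale:
  assumes "A \<subseteq> carrier L"
  shows "is_sublocale L (cjoin A)"
proof -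
  interpret S: complete_lattice "sublocales L" by (rule complete_lattice_sublocales)
  have "cjoin A \<in> carrier (sublocales L)"
    using assms closed_sublocale by (intro S.sup_closed) (auto simp: sublocales_def)
  then show ?thesis by (simp add: sublocales_def)
qed

lemma cjoin_eq:
  assumes "A \<subseteq> carrier L"
  shows "cjoin A = {\<Sqinter>M | M. M \<subseteq> carrier L \<and> (\<forall>m\<in>M. \<exists>a\<in>A. a \<sqsubseteq> m)}"
proof -
  have "cjoin A = {\<Sqinter>M | M. M \<subseteq> \<Union>(closed_sublocale L ` A)}"
    using assms closed_sublocale by (intro sublocale_sup) auto
  also have "\<dots> = {\<Sqinter>M | M. M \<subseteq> carrier L \<and> (\<forall>m\<in>M. \<exists>a\<in>A. a \<sqsubseteq> m)}"
    by (intro Collect_cong ex_cong1 conj_cong refl) (auto simp: closed_sublocale_def)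
  finally show ?thesis .
qed

lemma cjoin_upper:
  assumes "A \<subseteq> carrier L" "a \<in> A"
  shows "closed_sublocale L a \<subseteq> cjoin A"
proof
  fix x assume "x \<in> closed_sublocale L a"
  then have "x = \<Sqinter>{x}" "{x} \<subseteq> carrier L" "a \<sqsubseteq> x"
    by (auto simp: closed_sublocale_def)
  with assms have "\<exists>M. x = \<Sqinter>M \<and> M \<subseteq> carrier L \<and> (\<forall>m\<in>M. \<exists>a\<in>A. a \<sqsubseteq> m)"
    by (intro exI[of _ "{x}"]) auto
  with assms show "x \<in> cjoin A" by (simp add: cjoin_eq)
qed

lemma cjoin_least:
  assumes "A \<subseteq> carrier L" "is_sublocale L S" "\<And>a. a \<in> A \<Longrightarrow> closed_sublocale L a \<subseteq> S"
  shows "cjoin A \<subseteq> S"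
proof
  fix x assume "x \<in> cjoin A"
  then obtain M where M: "x = \<Sqinter>M" "M \<subseteq> carrier L" "\<forall>m\<in>M. \<exists>a\<in>A. a \<sqsubseteq> m"
    using cjoin_eq[OF assms(1)] by auto
  then have "M \<subseteq> S" using assms(3) by (fastforce simp: closed_sublocale_def)
  with M assms(2) show "x \<in> S" by (simp add: is_sublocale_def)
qed

lemma closed_joins_carrier:
  "S \<in> carrier (closed_joins L) \<longleftrightarrow> (\<exists>A \<subseteq> carrier L. S = cjoin A)"
  by (auto simp: closed_joins_def)

lemma closed_joins_le_iff:
  assumes "S \<in> carrier (closed_joins L)" "is_sublocale L T"
  shows "S \<subseteq> T \<longleftrightarrow> (\<forall>a\<in>carrier L. closed_sublocale L a \<subseteq> S \<longrightarrow> closed_sublocale L a \<subseteq> T)"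
proof
  assume R: "\<forall>a\<in>carrier L. closed_sublocale L a \<subseteq> S \<longrightarrow> closed_sublocale L a \<subseteq> T"
  obtain A where A: "A \<subseteq> carrier L" "S = cjoin A"
    using assms(1) closed_joins_carrier by blast
  have "cjoin A \<subseteq> T"
    using A R cjoin_upper[OF A(1)] by (intro cjoin_least assms(2)) blast+
  with A show "S \<subseteq> T" by simp
qed blast

lemma closed_joins_sublocale:
  "S \<in> carrier (closed_joins L) \<Longrightarrow> is_sublocale L S"
  using closed_joins_carrier cjoin_sublocale by auto

lemma closed_joins_lub:
  assumes "\<S> \<subseteq> carrier (closed_joins L)"
  shows "least (closed_joins L)
    (cjoin {a \<in> carrier L. \<exists>S\<in>\<S>. closed_sublocale L a \<subseteq> S}) (Upper (closed_joins L) \<S>)"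
    (is "least _ (cjoin ?A) _")
proof (rule least_UpperI)
  show "cjoin ?A \<in> carrier (closed_joins L)"
    unfolding closed_joins_carrier by (intro exI[of _ ?A]) auto
  fix S assume S: "S \<in> \<S>"
  have "S \<subseteq> cjoin ?A"
    using S assms cjoin_sublocale[of ?A] cjoin_upper[of ?A]
    by (subst closed_joins_le_iff) auto
  then show "S \<sqsubseteq>\<^bsub>closed_joins L\<^esub> cjoin ?A" by (simp add: closed_joins_def)
next
  fix T assume T: "T \<in> Upper (closed_joins L) \<S>"
  then have "is_sublocale L T" "\<And>S. S \<in> \<S> \<Longrightarrow> S \<subseteq> T"
    using assms closed_joins_sublocale by (auto simp: Upper_def closed_joins_def)
  then have "cjoin ?A \<subseteq> T" by (intro cjoin_least) auto
  then show "cjoin ?A \<sqsubseteq>\<^bsub>closed_joins L\<^esub> T" by (simp add: closed_joins_def)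
qed (use assms in auto)

lemma closed_joins_glb:
  assumes "\<S> \<subseteq> carrier (closed_joins L)"
  shows "greatest (closed_joins L)
    (cjoin {a \<in> carrier L. \<forall>S\<in>\<S>. closed_sublocale L a \<subseteq> S}) (Lower (closed_joins L) \<S>)"
    (is "greatest _ (cjoin ?A) _")
proof (rule greatest_LowerI)
  show "cjoin ?A \<in> carrier (closed_joins L)"
    unfolding closed_joins_carrier by (intro exI[of _ ?A]) auto
  fix S assume S: "S \<in> \<S>"
  then have "cjoin ?A \<subseteq> S"
    using assms closed_joins_sublocale by (intro cjoin_least) auto
  then show "cjoin ?A \<sqsubseteq>\<^bsub>closed_joins L\<^esub> S" by (simp add: closed_joins_def)
next
  fix T assume T: "T \<in> Lower (closed_joins L) \<S>"
  then have T': "T \<in> carrier (closed_joins L)" "\<And>S. S \<in> \<S> \<Longrightarrow> T \<subseteq> S"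
    using assms by (auto simp: Lower_def closed_joins_def)
  have "closed_sublocale L a \<subseteq> cjoin ?A"
    if "a \<in> carrier L" "closed_sublocale L a \<subseteq> T" for a
    using that T'(2) by (intro cjoin_upper) blast+
  then have "T \<subseteq> cjoin ?A"
    using T'(1) cjoin_sublocale[of ?A] by (subst closed_joins_le_iff) auto
  then show "T \<sqsubseteq>\<^bsub>closed_joins L\<^esub> cjoin ?A" by (simp add: closed_joins_def)
qed (use assms in auto)

theorem frame_closed_joins: "frame (closed_joins L)"
proof -
  interpret P: partial_order "closed_joins L"
    unfolding closed_joins_def by (rule partial_order_subsets)
  interpret C: complete_lattice "closed_joins L"
    using closed_joins_lub closed_joins_glb by (intro P.complete_latticeI) blast+
  have le: "X \<sqsubseteq>\<^bsub>closed_joins L\<^esub> Y \<longleftrightarrow> X \<subseteq> Y" for X Y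
    by (simp add: closed_joins_def)
  show ?thesis
  proof
    fix S \<T>
    assume S: "S \<in> carrier (closed_joins L)" and T: "\<T> \<subseteq> carrier (closed_joins L)"
    let ?J = "\<Squnion>\<^bsub>closed_joins L\<^esub>\<T>"
    let ?R = "\<Squnion>\<^bsub>closed_joins L\<^esub>((\<lambda>T. S \<sqinter>\<^bsub>closed_joins L\<^esub> T) ` \<T>)"
    have im: "(\<lambda>T. S \<sqinter>\<^bsub>closed_joins L\<^esub> T) ` \<T> \<subseteq> carrier (closed_joins L)"
      using S T by auto
    have J: "?J \<in> carrier (closed_joins L)" and R: "?R \<in> carrier (closed_joins L)"
      using T im by simp_all
    have Req: "is_sublocale L ?R" using R closed_joins_sublocale by blast
    have Jeq: "?J = cjoin {a \<in> carrier L. \<exists>T\<in>\<T>. closed_sublocale L a \<subseteq> T}"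
      using closed_joins_lub[OF T] C.sup_lub[OF T] by (rule P.least_unique[rotated])
    show "S \<sqinter>\<^bsub>closed_joins L\<^esub> ?J = ?R"
    proof (rule P.le_antisym)
      have "S \<sqinter>\<^bsub>closed_joins L\<^esub> ?J \<subseteq> ?R"
      proof (subst closed_joins_le_iff)
        show "\<forall>a\<in>carrier L. closed_sublocale L a \<subseteq> S \<sqinter>\<^bsub>closed_joins L\<^esub> ?J \<longrightarrow>
          closed_sublocale L a \<subseteq> ?R"
        proof (intro ballI impI subsetI)
          fix a x
          assume a: "a \<in> carrier L" and "closed_sublocale L a \<subseteq> S \<sqinter>\<^bsub>closed_joins L\<^esub> ?J"
            and x: "x \<in> closed_sublocale L a"
          then have aS: "closed_sublocale L a \<subseteq> S" and aJ: "closed_sublocale L a \<subseteq> ?J"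
            using C.meet_left[OF S J] C.meet_right[OF S J] by (auto simp: le)
          then obtain M where M: "x = \<Sqinter>M" "M \<subseteq> carrier L"
            "\<forall>m\<in>M. \<exists>b\<in>carrier L. (\<exists>T\<in>\<T>. closed_sublocale L b \<subseteq> T) \<and> b \<sqsubseteq> m"
          proof -
            have "x \<in> cjoin {a \<in> carrier L. \<exists>T\<in>\<T>. closed_sublocale L a \<subseteq> T}"
              using x aJ unfolding Jeq by blast
            then have "\<exists>M. x = \<Sqinter>M \<and> M \<subseteq> carrier L \<and>
              (\<forall>m\<in>M. \<exists>b\<in>{a \<in> carrier L. \<exists>T\<in>\<T>. closed_sublocale L a \<subseteq> T}. b \<sqsubseteq> m)"
              by (subst (asm) cjoin_eq) (simp_all add: subset_iff)
            then show ?thesis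
              by (elim exE conjE) (rule that; simp add: Bex_def conj_assoc)
          qed
          have "m \<in> ?R" if m: "m \<in> M" for m
          proof -
            obtain b T where b: "b \<in> carrier L" "T \<in> \<T>" "closed_sublocale L b \<subseteq> T" "b \<sqsubseteq> m"
              using bspec[OF M(3) m] by (elim bexE conjE)
            have mc: "m \<in> carrier L" using M m by auto
            have "a \<sqsubseteq> x" "x \<in> carrier L"
              using x by (simp_all add: closed_sublocale_def)
            moreover have "x \<sqsubseteq> m"
              unfolding M(1) by (rule inf_lower[OF M(2) m])
            ultimately have am: "a \<sqsubseteq> m" using le_trans[of a x m] a mc by simp
            have Tc: "T \<in> carrier (closed_joins L)" using b(2) T by (rule subsetD[rotated])
            have mem: "cjoin {m} \<subseteq> S" "cjoin {m} \<subseteq> T"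
            proof -
              have "closed_sublocale L m \<subseteq> closed_sublocale L a"
                "closed_sublocale L m \<subseteq> closed_sublocale L b"
                using le_trans[OF am _ a mc] le_trans[OF b(4) _ b(1) mc]
                by (auto simp: closed_sublocale_def)
              then have *: "closed_sublocale L m \<subseteq> S" "closed_sublocale L m \<subseteq> T"
                using aS b(3) by (meson order_trans)+
              show "cjoin {m} \<subseteq> S"
                using mc S * by (intro cjoin_least closed_joins_sublocale) simp_all
              show "cjoin {m} \<subseteq> T"
                using mc Tc * by (intro cjoin_least closed_joins_sublocale) simp_all
            qed
            have cm: "cjoin {m} \<in> carrier (closed_joins L)"
              unfolding closed_joins_carrier using mc by (intro exI[of _ "{m}"]) simp
            have "cjoin {m} \<sqsubseteq>\<^bsub>closed_joins L\<^esub> S \<sqinter>\<^bsub>closed_joins L\<^esub> T"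
              using mem cm S Tc by (intro C.meet_le) (simp_all add: le)
            moreover have "S \<sqinter>\<^bsub>closed_joins L\<^esub> T \<sqsubseteq>\<^bsub>closed_joins L\<^esub> ?R"
              using im b(2) by (intro C.sup_upper imageI)
            moreover have "m \<in> cjoin {m}"
              using cjoin_upper[of "{m}" m] mc by (simp add: closed_sublocale_def subset_iff)
            ultimately show ?thesis unfolding le by (meson subsetD)
          qed
          then show "x \<in> ?R" using M(1) is_sublocaleD(2)[OF Req, of M] by (simp add: subset_iff)
        qed
      qed (use S J Req in auto)
      then show "S \<sqinter>\<^bsub>closed_joins L\<^esub> ?J \<sqsubseteq>\<^bsub>closed_joins L\<^esub> ?R" by (simp add: le)
      show "?R \<sqsubseteq>\<^bsub>closed_joins L\<^esub> S \<sqinter>\<^bsub>closed_joins L\<^esub> ?J"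
      proof (rule C.sup_least[OF im])
        fix X assume "X \<in> (\<lambda>T. S \<sqinter>\<^bsub>closed_joins L\<^esub> T) ` \<T>"
        then obtain T where X: "X = S \<sqinter>\<^bsub>closed_joins L\<^esub> T" "T \<in> \<T>" by auto
        then have Tc: "T \<in> carrier (closed_joins L)" using T by auto
        have "T \<sqsubseteq>\<^bsub>closed_joins L\<^esub> ?J" using T X by (intro C.sup_upper)
        then show "X \<sqsubseteq>\<^bsub>closed_joins L\<^esub> S \<sqinter>\<^bsub>closed_joins L\<^esub> ?J"
          using C.meet_left[OF S Tc] C.meet_right[OF S Tc] X S Tc J
          by (intro C.meet_le) (auto simp: le)
      qed (use S J in simp)
    qed (use S J R in simp_all)
  qed
qed

end

section \<open>The frames of open sets and \<open>K_frame open_sets\<close>\<close>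

lemma frameI:
  assumes "partial_order L"
    and sup: "\<And>A. A \<subseteq> carrier L \<Longrightarrow> least L (s A) (Upper L A)"
    and meet: "\<And>a b. \<lbrakk>a \<in> carrier L; b \<in> carrier L\<rbrakk> \<Longrightarrow> greatest L (m a b) (Lower L {a, b})"
    and distrib: "\<And>a B. \<lbrakk>a \<in> carrier L; B \<subseteq> carrier L\<rbrakk> \<Longrightarrow> m a (s B) = s (m a ` B)"
  shows "frame L"
proof -
  interpret partial_order L by fact
  have "greatest L (s (Lower L A)) (Lower L A)" if A: "A \<subseteq> carrier L" for A
  proof (rule greatest_LowerI)
    have l: "least L (s (Lower L A)) (Upper L (Lower L A))" by (rule sup) simp
    then show "s (Lower L A) \<in> carrier L" by simp
    show "s (Lower L A) \<sqsubseteq>\<^bsub>L\<^esub> x" if "x \<in> A" for x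
      using l that A by (intro least_le[OF l]) (auto simp: Upper_def Lower_def)
    show "y \<sqsubseteq>\<^bsub>L\<^esub> s (Lower L A)" if "y \<in> Lower L A" for y
      using l that by (rule least_Upper_above) simp
  qed (rule A)
  then interpret complete_lattice L
    using sup by (intro complete_latticeI) blast+
  have s: "\<Squnion>\<^bsub>L\<^esub>A = s A" if "A \<subseteq> carrier L" for A
    using least_unique[OF sup_lub[OF that] sup[OF that]] .
  have m: "a \<sqinter>\<^bsub>L\<^esub> b = m a b" if "a \<in> carrier L" "b \<in> carrier L" for a b
    using greatest_unique[OF inf_glb meet] that by (simp add: meet_def)
  show ?thesis
  proof
    fix a B assume a: "a \<in> carrier L" and B: "B \<subseteq> carrier L"
    have im: "(\<lambda>b. a \<sqinter>\<^bsub>L\<^esub> b) ` B = m a ` B"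
      using a B by (intro image_cong refl) (auto simp: m)
    have "a \<sqinter>\<^bsub>L\<^esub> \<Squnion>\<^bsub>L\<^esub>B = m a (s B)"
      using a B s[OF B] m sup_closed by metis
    also have "\<dots> = \<Squnion>\<^bsub>L\<^esub>(m a ` B)"
      using distrib[OF a B] s[of "m a ` B"] a B im by (metis image_subsetI meet_closed subsetD)
    finally show "a \<sqinter>\<^bsub>L\<^esub> \<Squnion>\<^bsub>L\<^esub>B = \<Squnion>\<^bsub>L\<^esub>((\<lambda>b. a \<sqinter>\<^bsub>L\<^esub> b) ` B)"
      by (simp add: im)
  qed
qed

lemma frame_open_sets: "frame open_sets"
proof (rule frameI[where s = Union and m = "(\<inter>)"])
  show "partial_order open_sets"
    unfolding open_sets_def by (rule partial_order_subsets)
  show "least open_sets (\<Union>A) (Upper open_sets A)" if "A \<subseteq> carrier open_sets" 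
    for A :: "'a set set"
    using that by (intro least_UpperI) (auto simp: open_sets_def Upper_def)
  show "greatest open_sets (U \<inter> V) (Lower open_sets {U, V})"
    if "U \<in> carrier open_sets" "V \<in> carrier open_sets" for U V :: "'a set"
    using that by (intro greatest_LowerI) (auto simp: open_sets_def Lower_def)
qed auto

lemma pseudocomplement_open_sets:
  assumes "open U"
  shows "pseudocomplement open_sets U = - closure U"
proof -
  interpret O: frame "open_sets :: 'a set gorder" by (rule frame_open_sets)
  have carr: "V \<in> carrier open_sets \<longleftrightarrow> open V" and le: "V \<sqsubseteq>\<^bsub>open_sets\<^esub> W \<longleftrightarrow> V \<subseteq> W"
    for V W :: "'a set"
    by (auto simp: open_sets_def)
  have bot: "\<bottom>\<^bsub>open_sets\<^esub> = ({} :: 'a set)"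
    using O.bottom_lower[of "{}"] by (auto simp: carr le)
  have meet: "U \<sqinter>\<^bsub>open_sets\<^esub> V = U \<inter> V" if "open V" for V
  proof -
    have "U \<sqinter>\<^bsub>open_sets\<^esub> V \<subseteq> U \<inter> V"
      using O.meet_left[of U V] O.meet_right[of U V] assms that by (auto simp: carr le)
    moreover have "U \<inter> V \<subseteq> U \<sqinter>\<^bsub>open_sets\<^esub> V"
      using O.meet_le[of "U \<inter> V" U V] assms that by (auto simp: carr le)
    ultimately show ?thesis by blast
  qed
  have pc: "V \<subseteq> pseudocomplement open_sets U \<longleftrightarrow> U \<inter> V = {}" if "open V" for V
    using O.imp_galois[of U "{}" V] that assms
    unfolding pseudocomplement_def bot by (simp add: carr le meet)
  have op: "open (pseudocomplement open_sets U)"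
    using O.imp_closed[of U "{}"] unfolding pseudocomplement_def bot by (simp add: carr)
  have "- closure U \<subseteq> pseudocomplement open_sets U"
    using closure_subset[of U] by (subst pc) auto
  moreover have "U \<inter> pseudocomplement open_sets U = {}"
    using pc[OF op] by simp
  then have "pseudocomplement open_sets U \<subseteq> - closure U"
    using open_Int_closure_eq_empty[OF op] by blast
  ultimately show ?thesis by blast
qed

lemma carrier_booleanization_open_sets:
  "carrier (booleanization open_sets) = {V. open V \<and> V = interior (closure V)}"
proof -
  have "pseudocomplement open_sets (pseudocomplement open_sets V) = interior (closure V)"
    if "open V" for V :: "'a set"
    using that by (simp add: pseudocomplement_open_sets open_Compl interior_closure)
  then show ?thesis
    by (auto simp: booleanization_def open_sets_def)
qed

lemma K_frame_open_sets:
  "K_frame open_sets =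
    \<lparr>carrier = {(U, V). open U \<and> open V \<and> V = interior (closure V) \<and> U \<subseteq> V},
     eq = (=), le = (\<lambda>(U, V) (U', V'). U \<subseteq> U' \<and> V \<subseteq> V')\<rparr>"
  by (simp add: K_frame_def carrier_booleanization_open_sets) (auto simp: open_sets_def)

lemma regular_open_Int_Union:
  assumes "open W" "W = interior (closure W)" "\<And>V. V \<in> \<V> \<Longrightarrow> open V"
  shows "W \<inter> interior (closure (\<Union>\<V>)) = interior (closure (\<Union>V\<in>\<V>. W \<inter> V))"
proof
  have "W \<inter> closure (\<Union>\<V>) \<subseteq> closure (W \<inter> \<Union>\<V>)"
    using assms(1) by (rule open_Int_closure_subset)
  then have "interior (W \<inter> closure (\<Union>\<V>)) \<subseteq> interior (closure (W \<inter> \<Union>\<V>))"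
    by (rule interior_mono)
  then show "W \<inter> interior (closure (\<Union>\<V>)) \<subseteq> interior (closure (\<Union>V\<in>\<V>. W \<inter> V))"
    unfolding interior_Int interior_open[OF assms(1)] Int_Union .
  have sub: "(\<Union>V\<in>\<V>. W \<inter> V) \<subseteq> W" "(\<Union>V\<in>\<V>. W \<inter> V) \<subseteq> \<Union>\<V>" by auto
  show "interior (closure (\<Union>V\<in>\<V>. W \<inter> V)) \<subseteq> W \<inter> interior (closure (\<Union>\<V>))"
    using sub[THEN closure_mono, THEN interior_mono] unfolding assms(2)[symmetric]
    by (rule Int_greatest)
qed

lemma frame_K_frame_open_sets: "frame (K_frame (open_sets :: 'a::topological_space set gorder))"
proof (rule frameI)
  let ?K = "K_frame (open_sets :: 'a set gorder)"
  let ?s = "\<lambda>A :: ('a set \<times> 'a set) set. (\<Union>(fst ` A), interior (closure (\<Union>(snd ` A))))"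
  let ?m = "\<lambda>(p :: 'a set \<times> 'a set) (q :: 'a set \<times> 'a set). (fst p \<inter> fst q, snd p \<inter> snd q)"
  show "partial_order ?K"
    by unfold_locales (auto simp: K_frame_open_sets)
  show "least ?K (?s A) (Upper ?K A)" if A: "A \<subseteq> carrier ?K" for A
  proof (rule least_UpperI)
    have el: "open (fst x)" "open (snd x)" "fst x \<subseteq> snd x" if "x \<in> A" for x
      using subsetD[OF A that] by (auto simp: K_frame_open_sets split_beta)
    have op: "open (\<Union>(fst ` A))" "open (\<Union>(snd ` A))"
      by (rule open_UN; simp add: el)+
    have op': "\<Union>(fst ` A) \<subseteq> \<Union>(snd ` A)"
      by (rule UN_mono[OF subset_refl el(3)])
    have sub: "\<Union>(snd ` A) \<subseteq> interior (closure (\<Union>(snd ` A)))"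
      by (intro interior_maximal closure_subset op(2))
    have "interior (closure (interior (closure X))) = interior (closure X)" for X :: "'a set"
    proof
      show "interior (closure (interior (closure X))) \<subseteq> interior (closure X)"
        by (intro interior_mono closure_minimal interior_subset closed_closure)
      show "interior (closure X) \<subseteq> interior (closure (interior (closure X)))"
        by (simp add: closure_subset interior_maximal)
    qed
    then show "?s A \<in> carrier ?K"
      using op op' sub by (simp add: K_frame_open_sets)
    show "x \<sqsubseteq>\<^bsub>?K\<^esub> ?s A" if "x \<in> A" for x
    proof -
      have "fst x \<subseteq> \<Union>(fst ` A)" "snd x \<subseteq> \<Union>(snd ` A)" using that by blast+
      with sub show ?thesis by (simp add: K_frame_open_sets split_beta)
    qed
    show "?s A \<sqsubseteq>\<^bsub>?K\<^esub> y" if y: "y \<in> Upper ?K A" for y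
    proof -
      obtain U V where UV: "y = (U, V)" by (cases y)
      have b: "\<Union>(fst ` A) \<subseteq> U" "\<Union>(snd ` A) \<subseteq> V" "V = interior (closure V)"
      proof -
        have V: "(U, V) \<in> carrier ?K"
          using subsetD[OF Upper_closed y] unfolding UV .
        have "x \<sqsubseteq>\<^bsub>?K\<^esub> (U, V)" if "x \<in> A" for x
          using Upper_memD[OF y that A] unfolding UV by (rule conjunct1)
        then have "fst x \<subseteq> U \<and> snd x \<subseteq> V" if "x \<in> A" for x
          using that by (simp add: K_frame_open_sets split_beta)
        then show "\<Union>(fst ` A) \<subseteq> U" "\<Union>(snd ` A) \<subseteq> V" by blast+
        show "V = interior (closure V)" using V by (simp add: K_frame_open_sets)
      qed
      have "interior (closure (\<Union>(snd ` A))) \<subseteq> V"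
        using interior_mono[OF closure_mono[OF b(2)]] b(3)[symmetric] by (rule ord_le_eq_trans)
      then show ?thesis using b UV by (simp add: K_frame_open_sets)
    qed
  qed (rule A)
  show "greatest ?K (?m p q) (Lower ?K {p, q})"
    if pq: "p \<in> carrier ?K" "q \<in> carrier ?K" for p q
  proof (rule greatest_LowerI)
    have "interior (closure (V \<inter> W)) = V \<inter> W"
      if "open V" "V = interior (closure V)" "open W" "W = interior (closure W)"
      for V W :: "'a set"
      using regular_open_Int_Union[of V "{W}"] that(1,3) that(2,4)[symmetric] by simp
    then have "interior (closure (snd p \<inter> snd q)) = snd p \<inter> snd q"
      using pq by (simp add: K_frame_open_sets split_beta)
    then show "?m p q \<in> carrier ?K"
      using pq by (simp add: K_frame_open_sets split_beta open_Int) blast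
    fix x assume "x \<in> {p, q}"
    then show "?m p q \<sqsubseteq>\<^bsub>?K\<^esub> x"
      by (auto simp: K_frame_open_sets split_beta)
  next
    fix y assume y: "y \<in> Lower ?K {p, q}"
    have "{p, q} \<subseteq> carrier ?K" using pq by simp
    then have "y \<sqsubseteq>\<^bsub>?K\<^esub> p" "y \<sqsubseteq>\<^bsub>?K\<^esub> q"
      using Lower_memD[OF y] by simp_all
    then show "y \<sqsubseteq>\<^bsub>?K\<^esub> ?m p q"
      by (simp add: K_frame_open_sets split_beta)
  qed (use pq in simp)
  show "?m p (?s B) = ?s (?m p ` B)" if pB: "p \<in> carrier ?K" "B \<subseteq> carrier ?K" for p B
  proof -
    have "snd p \<inter> interior (closure (\<Union>(snd ` B))) =
      interior (closure (\<Union>V\<in>snd ` B. snd p \<inter> V))"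
    proof (rule regular_open_Int_Union)
      show "open (snd p)" "snd p = interior (closure (snd p))"
        using pB(1) by (simp_all add: K_frame_open_sets split_beta)
      fix V assume "V \<in> snd ` B"
      then obtain b where "b \<in> B" "V = snd b" by blast
      then show "open V"
        using subsetD[OF pB(2), of b] by (simp add: K_frame_open_sets split_beta)
    qed
    then show ?thesis by (auto simp: image_image)
  qed
qed

corollary frame_closed_joins_K:
  "frame (closed_joins (K_frame (open_sets :: 'a::topological_space set gorder)))"
  using frame.frame_closed_joins[OF frame_K_frame_open_sets] .

end

theory Submission
  imports Defs
begin

text \<open>
  Over the reals, a join of closed sublocales of \<^term>\<open>K_frame open_sets\<close> records a
  set of points \<open>P\<close> (those \<open>x\<close> for which it contains the element \<open>(- {x}, UNIV)\<close>, maximal below the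
  top) together with a regular open set \<open>W\<close> in which the interior of \<open>P\<close> is dense; the pair grows
  independently in both coordinates under joins, but under meets \<open>W\<close> has to shrink along with the
  interior of \<open>P\<close>. This is where the dual distributive law breaks.

  Let \<open>S\<close> be the closed sublocale of \<open>({}, UNIV)\<close>, which has all points but \<open>W = {}\<close>, and
  for each point \<open>q\<close> let \<open>T q\<close> (below: \<open>avoiding q\<close>) be the join of the closed sublocales of all \<open>(U, V)\<close> with \<open>q \<in> U\<close>,
  which misses only the point \<open>q\<close> and has \<open>W = UNIV\<close>. In a space without isolated
  points, adding one point to a closed set does not enlarge its interior, so \<open>S\<close> and \<open>T q\<close> together generate
  everything (\<open>K_meet_generators\<close>). On the other hand nothing but the top element can lie in the
  meet of all the \<open>T q\<close>, because a closed sublocale inside \<open>T q\<close> does not see the point \<open>q\<close>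
  (\<open>mem_if_closed_sublocale_le_avoiding\<close>). Thus the join of \<open>S\<close> with the meet of all \<open>T q\<close> is \<open>S\<close>,
  whereas the meet of the joins of \<open>S\<close> with \<open>T q\<close> is the whole frame.
\<close>

lemma coframe_join_inf_distrib:
  assumes "coframe L" "a \<in> carrier L" "B \<subseteq> carrier L"
  shows "a \<squnion>\<^bsub>L\<^esub> \<Sqinter>\<^bsub>L\<^esub>B = \<Sqinter>\<^bsub>L\<^esub>((\<lambda>b. a \<squnion>\<^bsub>L\<^esub> b) ` B)"
proof -
  have "\<Squnion>\<^bsub>inv_gorder L\<^esub>A = \<Sqinter>\<^bsub>L\<^esub>A" "\<Sqinter>\<^bsub>inv_gorder L\<^esub>A = \<Squnion>\<^bsub>L\<^esub>A" for A
    by (simp_all add: Lattice.sup_def Lattice.inf_def)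
  then have "x \<sqinter>\<^bsub>inv_gorder L\<^esub> y = x \<squnion>\<^bsub>L\<^esub> y" "\<Squnion>\<^bsub>inv_gorder L\<^esub>A = \<Sqinter>\<^bsub>L\<^esub>A" for x y A
    by (simp_all add: meet_def join_def)
  with frame.meet_sup_distrib[of "inv_gorder L" a B] assms show ?thesis
    by (simp add: coframe_def)
qed

lemma (in frame) cjoin_singleton:
  assumes "a \<in> carrier L"
  shows "\<Squnion>\<^bsub>sublocales L\<^esub>(closed_sublocale L ` {a}) = closed_sublocale L a"
  using assms by (intro equalityI cjoin_least cjoin_upper closed_sublocale) auto

lemma (in frame) closed_sublocale_in_closed_joins:
  assumes "a \<in> carrier L"
  shows "closed_sublocale L a \<in> carrier (closed_joins L)"
  using cjoin_singleton[OF assms] assms unfolding closed_joins_carrier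
  by (metis empty_subsetI insert_subset)

abbreviation K_open :: "('a::topological_space set \<times> 'a set) gorder"
  where "K_open \<equiv> K_frame open_sets"

lemma carrier_K_open:
  "(U, V) \<in> carrier K_open \<longleftrightarrow> open U \<and> open V \<and> interior (closure V) = V \<and> U \<subseteq> V"
  unfolding K_frame_open_sets by (simp add: eq_commute[of V])

lemma le_K_open: "(U, V) \<sqsubseteq>\<^bsub>K_open\<^esub> (U', V') \<longleftrightarrow> U \<subseteq> U' \<and> V \<subseteq> V'"
  by (simp add: K_frame_open_sets)

lemma interior_closure_Compl_cball:
  fixes y :: "'a::{real_normed_vector, perfect_space}"
  assumes "r > 0"
  shows "interior (closure (- cball y r)) = - cball y r"
  using assms by (simp add: closure_complement interior_complement interior_cball)

text \<open>Otherwise \<open>q\<close> would be an isolated point.\<close>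

lemma open_subset_closed_if_insert:
  fixes q :: "'a::perfect_space"
  assumes "open Y" "closed C" "Y \<subseteq> insert q C"
  shows "Y \<subseteq> C"
proof (rule ccontr)
  assume "\<not> Y \<subseteq> C"
  with assms(3) have "Y - C = {q}" by blast
  moreover have "open (Y - C)" using assms by (intro open_Diff)
  ultimately show False using not_open_singleton[of q] by simp
qed

text \<open>
  The pair \<open>(U, V)\<close> is the meet of \<open>(U, UNIV)\<close> and \<open>(V, V)\<close>, and \<open>V\<close> is the
  interior of an intersection of complements of closed balls. Balls that avoid \<open>q\<close> suffice, because
  they recover \<open>V\<close> up to the single point \<open>q\<close>, which is not isolated.
\<close>

lemma K_meet_generators:
  fixes q :: "'a::{real_normed_vector, perfect_space}"
  assumes UV: "(U, V) \<in> carrier K_open"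
  shows "\<Sqinter>\<^bsub>K_open\<^esub>{(U', V') \<in> carrier K_open. U \<subseteq> U' \<and> V \<subseteq> V' \<and> (V' = UNIV \<or> q \<in> U')} = (U, V)"
    (is "\<Sqinter>\<^bsub>K_open\<^esub>?M = _")
proof -
  interpret K: frame "K_open :: ('a set \<times> 'a set) gorder"
    by (rule frame_K_frame_open_sets)
  have M: "?M \<subseteq> carrier K_open" by auto
  obtain X Y where XY: "\<Sqinter>\<^bsub>K_open\<^esub>?M = (X, Y)" by (rule prod.exhaust)
  have XYc: "(X, Y) \<in> carrier K_open" using K.inf_closed[OF M] by (simp add: XY)
  have lower: "X \<subseteq> U' \<and> Y \<subseteq> V'" if "(U', V') \<in> ?M" for U' V'
    using K.inf_lower[OF M that] by (simp add: XY le_K_open)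
  have "(U, V) \<sqsubseteq>\<^bsub>K_open\<^esub> \<Sqinter>\<^bsub>K_open\<^esub>?M"
    by (rule K.inf_greatest[OF M UV]) (clarsimp simp: le_K_open)
  then have ge: "U \<subseteq> X" "V \<subseteq> Y" by (simp_all add: XY le_K_open)
  have "X \<subseteq> U"
    using lower[of U UNIV] UV by (simp add: carrier_K_open)
  moreover have "Y \<subseteq> V"
  proof -
    have "y \<notin> Y" if y: "y \<notin> closure V" "y \<noteq> q" for y
    proof -
      have "open (- insert q (closure V))" "y \<in> - insert q (closure V)"
        using y by auto
      then obtain r where r: "r > 0" "cball y r \<subseteq> - insert q (closure V)"
        using open_contains_cball by blast
      then have "V \<subseteq> - cball y r" "q \<notin> cball y r"
        using closure_subset[of V] by blast+
      moreover from this have "U \<subseteq> - cball y r"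
        using UV unfolding carrier_K_open by (meson order_trans)
      moreover have "open (- cball y r)" by (intro open_Compl closed_cball)
      ultimately have "(- cball y r, - cball y r) \<in> ?M"
        unfolding mem_Collect_eq prod.case carrier_K_open
        using interior_closure_Compl_cball[OF r(1), of y] by blast
      then have "Y \<subseteq> - cball y r" by (rule lower[THEN conjunct2])
      moreover have "y \<in> cball y r" using r(1) by simp
      ultimately show ?thesis by blast
    qed
    then have "Y \<subseteq> insert q (closure V)" by blast
    with _ closed_closure have "Y \<subseteq> closure V"
      by (rule open_subset_closed_if_insert) (use XYc in \<open>simp add: carrier_K_open\<close>)
    then have "Y \<subseteq> interior (closure V)"
      using XYc by (intro interior_maximal) (simp_all add: carrier_K_open)
    then show ?thesis using UV by (simp add: carrier_K_open)
  qed
  ultimately show ?thesis using ge by (simp add: XY)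
qed

text \<open>
  In a T1 space the elements \<open>(- {x}, UNIV)\<close> play the role of points, and this join contains
  exactly those with \<open>x \<noteq> q\<close>.
\<close>

definition avoiding :: "'a::topological_space \<Rightarrow> ('a set \<times> 'a set) set"
  where "avoiding q =
    \<Squnion>\<^bsub>sublocales K_open\<^esub>(closed_sublocale K_open ` {(U, V) \<in> carrier K_open. q \<in> U})"

lemma avoiding_in_closed_joins: "avoiding q \<in> carrier (closed_joins K_open)"
  unfolding avoiding_def frame.closed_joins_carrier[OF frame_K_frame_open_sets]
  by (intro exI[of _ "{(U, V) \<in> carrier K_open. q \<in> U}"] conjI refl) auto

text \<open>
  If \<open>q\<close> were outside \<open>U\<close>, then \<open>(- {q}, UNIV)\<close> would lie in the closed sublocale of \<open>(U, V)\<close>. The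
  only element strictly above it is the top, so it is no meet of pairs whose first component
  contains \<open>q\<close>.
\<close>

lemma mem_if_closed_sublocale_le_avoiding:
  fixes q :: "'a::t1_space"
  assumes UV: "(U, V) \<in> carrier K_open"
    and sub: "closed_sublocale K_open (U, V) \<subseteq> avoiding q"
  shows "q \<in> U"
proof (rule ccontr)
  interpret K: frame "K_open :: ('a set \<times> 'a set) gorder"
    by (rule frame_K_frame_open_sets)
  assume "q \<notin> U"
  then have "U \<subseteq> - {q}" by blast
  moreover have "open (- {q})" by (intro open_Compl closed_singleton)
  ultimately have "(- {q}, UNIV) \<in> closed_sublocale K_open (U, V)"
    by (simp add: closed_sublocale_def carrier_K_open le_K_open)
  with sub have "(- {q}, UNIV) \<in> avoiding q" by blast
  then obtain M where M: "(- {q}, UNIV) = \<Sqinter>\<^bsub>K_open\<^esub>M" "M \<subseteq> carrier K_open"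
    and M_above: "\<forall>m\<in>M. \<exists>a\<in>{(U, V) \<in> carrier K_open. q \<in> U}. a \<sqsubseteq>\<^bsub>K_open\<^esub> m"
  proof -
    have "{(U, V) \<in> carrier K_open. q \<in> U} \<subseteq> carrier K_open" by auto
    from \<open>(- {q}, UNIV) \<in> avoiding q\<close>[unfolded avoiding_def K.cjoin_eq[OF this]] show ?thesis
      by (elim CollectE exE conjE) (rule that)
  qed
  have "(UNIV, UNIV) \<sqsubseteq>\<^bsub>K_open\<^esub> m" if m: "m \<in> M" for m
  proof -
    obtain U' V' where m_eq: "m = (U', V')" by (rule prod.exhaust)
    obtain a where "a \<in> {(U, V) \<in> carrier K_open. q \<in> U}" "a \<sqsubseteq>\<^bsub>K_open\<^esub> m"
      using bspec[OF M_above m] by (rule bexE)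
    then have "q \<in> U'"
      by (cases a) (simp add: m_eq le_K_open subset_iff)
    have "(- {q}, UNIV) \<sqsubseteq>\<^bsub>K_open\<^esub> m"
      unfolding M(1) using M(2) m by (rule K.inf_lower)
    then have "- {q} \<subseteq> U'" "UNIV \<subseteq> V'" by (simp_all add: m_eq le_K_open)
    moreover have "insert q (- {q}) = UNIV" by auto
    ultimately have "UNIV \<subseteq> U'" using \<open>q \<in> U'\<close> by (metis insert_subset)
    with \<open>UNIV \<subseteq> V'\<close> show ?thesis by (simp add: m_eq le_K_open)
  qed
  then have "(UNIV, UNIV) \<sqsubseteq>\<^bsub>K_open\<^esub> \<Sqinter>\<^bsub>K_open\<^esub>M"
    using M(2) by (intro K.inf_greatest) (simp_all add: carrier_K_open)
  then show False by (simp add: M(1)[symmetric] le_K_open)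
qed

text \<open>
  A sublocale is closed under meets, and every generator in \<open>K_meet_generators\<close> lies in one of the two
  given closed joins: those with second component \<open>UNIV\<close> are above \<open>({}, UNIV)\<close>, the
  others have \<open>q\<close> in the first component.
\<close>

lemma carrier_subset_if_avoiding_subset:
  fixes X :: "('a::{real_normed_vector, perfect_space} set \<times> 'a set) set"
  assumes "is_sublocale K_open X" "avoiding q \<subseteq> X" "closed_sublocale K_open ({}, UNIV) \<subseteq> X"
  shows "carrier K_open \<subseteq> X"
proof
  interpret K: frame "K_open :: ('a set \<times> 'a set) gorder"
    by (rule frame_K_frame_open_sets)
  fix x :: "'a set \<times> 'a set"
  assume x: "x \<in> carrier K_open"
  obtain U V where x_eq: "x = (U, V)" by (rule prod.exhaust)
  let ?A = "{(U, V) \<in> carrier K_open. q \<in> U}"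
  let ?M = "{(U', V') \<in> carrier K_open. U \<subseteq> U' \<and> V \<subseteq> V' \<and> (V' = UNIV \<or> q \<in> U')}"
  have "m \<in> X" if "m \<in> ?M" for m
  proof -
    obtain U' V' where m_eq: "m = (U', V')" by (rule prod.exhaust)
    have m: "(U', V') \<in> carrier K_open" "V' = UNIV \<or> q \<in> U'"
      using that by (simp_all add: m_eq)
    from m(2) show ?thesis
    proof
      assume "V' = UNIV"
      then have "m \<in> closed_sublocale K_open ({}, UNIV)"
        using m(1) by (simp add: m_eq closed_sublocale_def le_K_open)
      with assms(3) show ?thesis by (rule subsetD)
    next
      assume "q \<in> U'"
      then have "m \<in> ?A" using m(1) by (simp add: m_eq)
      moreover have "?A \<subseteq> carrier K_open" by auto
      ultimately have "closed_sublocale K_open m \<subseteq> avoiding q"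
        unfolding avoiding_def by (intro K.cjoin_upper)
      also note assms(2)
      finally have "closed_sublocale K_open m \<subseteq> X" .
      moreover have "m \<in> closed_sublocale K_open m"
        using m(1) by (simp add: m_eq closed_sublocale_def le_K_open)
      ultimately show ?thesis by (rule subsetD)
    qed
  qed
  then have "?M \<subseteq> X" by (rule subsetI)
  then have "\<Sqinter>\<^bsub>K_open\<^esub>?M \<in> X" by (rule is_sublocaleD(2)[OF assms(1)])
  then show "x \<in> X"
    unfolding x_eq K_meet_generators[OF x[unfolded x_eq]] .
qed

text \<open>
  The reals enter only through two properties: points are closed but not isolated, and complements
  of closed balls are regular open sets that separate points from closed sets.
\<close>

theorem closed_joins_K_open_not_coframe:
  "\<not> coframe (closed_joins (K_open :: ('a::{real_normed_vector, perfect_space} set \<times> 'a set) gorder))"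
    (is "\<not> coframe (closed_joins ?K)")
proof
  assume coframe: "coframe (closed_joins ?K)"
  interpret K: frame ?K by (rule frame_K_frame_open_sets)
  interpret C: frame "closed_joins ?K" by (rule frame_closed_joins_K)
  have le: "X \<sqsubseteq>\<^bsub>closed_joins ?K\<^esub> Y \<longleftrightarrow> X \<subseteq> Y" for X Y
    by (simp add: closed_joins_def)
  define S where "S = closed_sublocale ?K ({}, UNIV)"
  let ?join = "\<lambda>q. S \<squnion>\<^bsub>closed_joins ?K\<^esub> avoiding q"
  let ?I = "\<Sqinter>\<^bsub>closed_joins ?K\<^esub>(range avoiding)"
  have Sc: "S \<in> carrier (closed_joins ?K)"
    unfolding S_def by (rule K.closed_sublocale_in_closed_joins) (simp add: carrier_K_open)
  have Ts: "range avoiding \<subseteq> carrier (closed_joins ?K)"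
    using avoiding_in_closed_joins by blast
  have Ic: "?I \<in> carrier (closed_joins ?K)" using Ts by (rule C.inf_closed)
  have joinc: "?join q \<in> carrier (closed_joins ?K)" for q
    using Sc avoiding_in_closed_joins by (rule C.join_closed)

  have "?I \<subseteq> S"
  proof (subst K.closed_joins_le_iff[OF Ic], goal_cases)
    case 1
    show ?case using Sc by (rule K.closed_joins_sublocale)
  next
    case 2
    show ?case
    proof (intro ballI impI)
      fix a assume a: "a \<in> carrier ?K" "closed_sublocale ?K a \<subseteq> ?I"
      obtain U V where a_eq: "a = (U, V)" by (rule prod.exhaust)
      have "q \<in> U" for q
      proof (rule mem_if_closed_sublocale_le_avoiding)
        show "(U, V) \<in> carrier ?K" using a a_eq by simp
        have "?I \<subseteq> avoiding q"
          using C.inf_lower[OF Ts, of "avoiding q"] by (simp add: le)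
        then show "closed_sublocale ?K (U, V) \<subseteq> avoiding q"
          using a(2) unfolding a_eq by (rule order_trans[rotated])
      qed
      then have "U = UNIV" by (rule UNIV_eq_I[symmetric])
      then have "V = UNIV" using a by (simp add: a_eq carrier_K_open top_unique)
      then show "closed_sublocale ?K a \<subseteq> S"
        unfolding S_def a_eq closed_sublocale_def by (auto simp: le_K_open)
    qed
  qed
  then have "S \<squnion>\<^bsub>closed_joins ?K\<^esub> ?I \<subseteq> S"
    using C.join_le[of S S ?I] Sc Ic by (simp add: le)
  moreover have "S \<squnion>\<^bsub>closed_joins ?K\<^esub> ?I = \<Sqinter>\<^bsub>closed_joins ?K\<^esub>(range ?join)"
    using coframe_join_inf_distrib[OF coframe Sc Ts] unfolding image_image .
  moreover have "closed_sublocale ?K ({}, {}) \<subseteq> \<Sqinter>\<^bsub>closed_joins ?K\<^esub>(range ?join)"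
  proof -
    have "carrier ?K \<subseteq> ?join q" for q
    proof (rule carrier_subset_if_avoiding_subset)
      show "is_sublocale ?K (?join q)" using joinc by (rule K.closed_joins_sublocale)
      show "avoiding q \<subseteq> ?join q"
        using C.join_right[OF Sc avoiding_in_closed_joins] by (simp add: le)
      show "closed_sublocale ?K ({}, UNIV) \<subseteq> ?join q"
        using C.join_left[OF Sc avoiding_in_closed_joins] by (simp add: le S_def)
    qed
    moreover have "closed_sublocale ?K ({}, {}) \<subseteq> carrier ?K"
      unfolding closed_sublocale_def by (rule Collect_restrict)
    ultimately have below: "closed_sublocale ?K ({}, {}) \<subseteq> ?join q" for q
      by (rule order_trans[rotated])
    have "closed_sublocale ?K ({}, {}) \<sqsubseteq>\<^bsub>closed_joins ?K\<^esub> \<Sqinter>\<^bsub>closed_joins ?K\<^esub>(range ?join)"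
    proof (rule C.inf_greatest)
      show "range ?join \<subseteq> carrier (closed_joins ?K)" using joinc by (rule image_subsetI)
      show "closed_sublocale ?K ({}, {}) \<in> carrier (closed_joins ?K)"
        by (rule K.closed_sublocale_in_closed_joins) (simp add: carrier_K_open)
      show "closed_sublocale ?K ({}, {}) \<sqsubseteq>\<^bsub>closed_joins ?K\<^esub> T" if "T \<in> range ?join" for T
        using that unfolding le by (elim rangeE) (simp only: below)
    qed
    then show ?thesis by (simp add: le)
  qed
  ultimately have "closed_sublocale ?K ({}, {}) \<subseteq> S" by simp
  moreover have "({}, {}) \<in> closed_sublocale ?K ({}, {})"
    by (simp add: closed_sublocale_def carrier_K_open le_K_open)
  ultimately have "({}, {}) \<in> S" by (rule subsetD)
  then show False
    by (simp add: S_def closed_sublocale_def le_K_open)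
qed

theorem corollary3p6:
  shows "\<not> coframe (closed_joins (K_frame (open_sets :: real set gorder)))"
  by (rule closed_joins_K_open_not_coframe)

end
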